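(* For every $i\ge0$: $\nu(Z_{i,0}(d_{i,0}))=0$; $$\nu(Z_{i,0}(d_{i,0}+1))\ \begin{cases}=1,& i\equiv 2\pmod 4,\\ \ge 2,& i\not\equiv 2\pmod 4;\end{cases}$$ and for every $M\ge2$, $\nu(Z_{i,0}(d_{i,0}+M))\ge M+1$.
   Context: Let $E(q)=\prod_{m\ge1}(1-q^m)$. Define $$\gamma(q)=\frac{E(q)^5E(q^2)^5E(q^6)^5}{E(q^3)^{15}},\quad \xi=\xi(q)=\frac{E(q^2)^5E(q^6)}{E(q)E(q^3)^5},\quad \kappa(q)=\frac{\gamma(q^2)^2}{\gamma(q)},$$ and let $U\left(\sum_n a_nq^n\right)=\sum_n a_{2n}q^n$. For $i,j\ge0$, $\zeta_{i,j}=U(\kappa^i\xi^j)$, which equals a polynomial in $\xi$ with integer coefficients; write $\zeta_{i,j}=\sum_m Z_{i,j}(m)\xi^m$. Define $d_{i,j}=5I+J$ if $(i,j)=(2I,2J)$; $5I+J+1$ if $(i,j)=(2I,2J+1)$; $5I+J+3$ if $(i,j)=(2I+1,2J)$ or $(2I+1,2J+1)$. $\nu(n)$ is the $2$-adic valuation of an integer $n$ (the largest $\alpha\ge0$ with $2^\alpha\mid n$), with $\nu(0)=\infty$. *)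

theory Defs
  imports "HOL-Computational_Algebra.Computational_Algebra" "HOL-Library.Extended_Nat"
begin

(* E(q) = prod_{m>=1} (1 - q^m) as a formal power series: its n-th coefficient
   agrees with that of the finite product over m = 1..n (X-adic limit). *)
definition E_fps :: "rat fps" where
  "E_fps = Abs_fps (\<lambda>n. (\<Prod>m\<in>{1..n}. (1 - fps_X ^ m :: rat fps)) $ n)"

definition dilate :: "nat \<Rightarrow> rat fps \<Rightarrow> rat fps" where
  "dilate k f = Abs_fps (\<lambda>n. if k dvd n then f $ (n div k) else 0)"

definition U_op :: "rat fps \<Rightarrow> rat fps" where
  "U_op f = Abs_fps (\<lambda>n. f $ (2 * n))"

definition gamma_fps :: "rat fps" where
  "gamma_fps = E_fps ^ 5 * dilate 2 E_fps ^ 5 * dilate 6 E_fps ^ 5 * inverse (dilate 3 E_fps ^ 15)"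

definition xi_fps :: "rat fps" where
  "xi_fps = dilate 2 E_fps ^ 5 * dilate 6 E_fps * inverse (E_fps * dilate 3 E_fps ^ 5)"

definition kappa_fps :: "rat fps" where
  "kappa_fps = dilate 2 gamma_fps ^ 2 * inverse gamma_fps"

definition zeta_poly :: "nat \<Rightarrow> nat \<Rightarrow> int poly" where
  "zeta_poly i j = (THE p. U_op (kappa_fps ^ i * xi_fps ^ j)
       = poly (map_poly (\<lambda>c. fps_const (of_int c)) p) xi_fps)"

definition Z :: "nat \<Rightarrow> nat \<Rightarrow> nat \<Rightarrow> int" where
  "Z i j m = coeff (zeta_poly i j) m"

definition d_idx :: "nat \<Rightarrow> nat \<Rightarrow> nat" where
  "d_idx i j = (if even i then 5 * (i div 2) + j div 2 + (if even j then 0 else 1)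
                else 5 * (i div 2) + j div 2 + 3)"

definition nu2 :: "int \<Rightarrow> enat" where
  "nu2 n = (if n = 0 then \<infinity> else enat (multiplicity (2::int) n))"

end

(* The function G = E(q)^{-1} E(q^3)^3 has even and odd parts that are eta quotients:
   A = E(q^4)^3 E(q^6)^2 / (E(q^2)^2 E(q^12)) is the even one.  By the Jacobi triple product G is,
   up to a factor in q^2, the product of the theta series with exponents 3n^2 - 2n and 3m^2, and
   splitting the lattice of pairs (n, m) by the parity of n + m separates the two parts.
   With y = xi(q^2) one has A^2 = y G(q) G(-q), and kappa = C G^5 with C even and C A^5 = y^5.
   Hence kappa(q) and kappa(-q) have sum 2 y^3 (16 y^2 - 20 y + 5) and product y^5, so that
   zeta_{i,0}, which at q^2 is half the sum of their i-th powers, satisfies a linear recurrence.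
   (It is y^(5i/2) T_{5i}(sqrt y) with T the Chebyshev polynomial.)  After removing the power of y,
   the recurrence is over Z[4y] for odd i, and for even i after doubling; this gives the
   2-divisibility of all coefficients at once. *)
theory Submission
  imports Defs
begin

section \<open>Coefficientwise limits and substitutions\<close>

text \<open>Convergence means that each coefficient is eventually constant, and coefficient N of a
  product involves only the coefficients up to N of its factors.\<close>

lemma tendsto_mult_fps:
  fixes F G :: "'a::ring fps"
  assumes "(f \<longlongrightarrow> F) \<F>" and "(g \<longlongrightarrow> G) \<F>"
  shows "((\<lambda>n. f n * g n) \<longlongrightarrow> F * G) \<F>"
proof (rule tendsto_fpsI)
  fix N
  have "\<forall>\<^sub>F n in \<F>. \<forall>k\<le>N. f n $ k = F $ k" "\<forall>\<^sub>F n in \<F>. \<forall>k\<le>N. g n $ k = G $ k"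
    using assms eventually_fps_nth_eq_nhds_fps_strong[of N] by (auto simp: filterlim_iff)
  thus "\<forall>\<^sub>F n in \<F>. (f n * g n) $ N = (F * G) $ N"
    by eventually_elim (auto simp: fps_mult_nth intro!: sum.cong)
qed

lemma tendsto_fps_compose:
  fixes F :: "'a::comm_ring_1 fps"
  assumes "(f \<longlongrightarrow> F) \<F>"
  shows "((\<lambda>n. fps_compose (f n) c) \<longlongrightarrow> fps_compose F c) \<F>"
proof (rule tendsto_fpsI)
  fix N
  have "\<forall>\<^sub>F n in \<F>. \<forall>k\<le>N. f n $ k = F $ k"
    using assms eventually_fps_nth_eq_nhds_fps_strong[of N] by (auto simp: filterlim_iff)
  thus "\<forall>\<^sub>F n in \<F>. fps_compose (f n) c $ N = fps_compose F c $ N"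
    by eventually_elim (auto simp: fps_compose_nth intro!: sum.cong)
qed

lemma dilate_conv_compose: "k > 0 \<Longrightarrow> dilate k f = fps_compose f (fps_X ^ k)"
  by (rule fps_ext)
     (auto simp: dilate_def fps_compose_nth if_distrib power_mult [symmetric]
           sum.delta dvd_def cong: if_cong elim!: dvdE)

lemma dilate_nth: "dilate k f $ n = (if k dvd n then f $ (n div k) else 0)"
  by (simp add: dilate_def)

lemma dilate_mult: "k > 0 \<Longrightarrow> dilate k (f * g) = dilate k f * dilate k g"
  by (simp add: dilate_conv_compose fps_compose_mult_distrib)

lemma dilate_power: "k > 0 \<Longrightarrow> dilate k (f ^ n) = dilate k f ^ n"
  by (simp add: dilate_conv_compose fps_compose_power)

lemma dilate_inverse: "k > 0 \<Longrightarrow> f $ 0 \<noteq> 0 \<Longrightarrow> dilate k (inverse f) = inverse (dilate k f)"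
  by (simp add: dilate_conv_compose fps_inverse_compose)

lemma dilate_dilate: "a > 0 \<Longrightarrow> dilate a (dilate b f) = dilate (a * b) f"
  by (rule fps_ext)
     (auto simp: dilate_nth dvd_div_iff_mult div_mult2_eq mult.commute elim: dvd_mult_left)

lemma dilate_1 [simp]: "dilate 1 f = f" "dilate (Suc 0) f = f"
  by (auto simp: fps_eq_iff dilate_nth)

lemma dilate_inject: "k > 0 \<Longrightarrow> dilate k f = dilate k g \<longleftrightarrow> f = g"
proof (auto, rule fps_ext)
  fix n assume "k > 0" "dilate k f = dilate k g"
  hence "dilate k f $ (k * n) = dilate k g $ (k * n)" by simp
  with \<open>k > 0\<close> show "f $ n = g $ n" by (simp add: dilate_nth)
qed

lemma compose_minus_X_nth: "fps_compose f (- fps_X) $ n = (-1) ^ n * (f $ n :: rat)"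
proof -
  have "(- fps_X :: rat fps) ^ i $ n = (if n = i then (-1) ^ n else 0)" for i
    by (cases "even i") (auto simp: power_minus_odd)
  thus ?thesis unfolding fps_compose_nth by (simp only:) (simp add: if_distrib cong: if_cong)
qed

lemma compose_one_minus_X_power:
  fixes c :: "'a::idom fps"
  shows "c $ 0 = 0 \<Longrightarrow> fps_compose (1 - fps_X ^ m) c = 1 - c ^ m"
  by (simp add: fps_compose_sub_distrib flip: fps_compose_power)

lemma dilate_even_compose_minus_X: "even k \<Longrightarrow> fps_compose (dilate k f) (- fps_X) = dilate k f"
  by (auto simp: fps_eq_iff compose_minus_X_nth dilate_nth elim!: dvdE)

text \<open>For odd k the numbers k*m and m have the same parity, so q -> q^k commutes with q ->
  -q.\<close>

lemma dilate_odd_compose_minus_X: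
  "odd k \<Longrightarrow> fps_compose (dilate k f) (- fps_X) = dilate k (fps_compose f (- fps_X))"
proof (rule fps_ext)
  fix n assume "odd k"
  show "fps_compose (dilate k f) (- fps_X) $ n = dilate k (fps_compose f (- fps_X)) $ n"
  proof (cases "k dvd n")
    case True
    then obtain m where "n = k * m" by blast
    moreover have "k > 0" using \<open>odd k\<close> by (cases k) auto
    ultimately show ?thesis using \<open>odd k\<close>
      by (cases "even m") (auto simp: compose_minus_X_nth dilate_nth)
  qed (auto simp: compose_minus_X_nth dilate_nth)
qed

section \<open>Finite q-products\<close>

text \<open>The q-Pochhammer symbol (q^k; q^k)_n, a finite stage of E(q^k).\<close>

definition qfac :: "nat \<Rightarrow> nat \<Rightarrow> rat fps" where
  "qfac k n = (\<Prod>m<n. 1 - fps_X ^ (k * Suc m))"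

lemma qfac_0 [simp]: "qfac k 0 = 1"
  and qfac_Suc: "qfac k (Suc n) = qfac k n * (1 - fps_X ^ (k * Suc n))"
  by (simp_all add: qfac_def)

lemma qfac_nth_stable:
  assumes "k > 0" "t \<le> n"
  shows "qfac k (n + d) $ t = qfac k n $ t"
proof (induction d)
  case (Suc d)
  have "t < k * Suc (n + d)" using assms by (cases k) auto
  with Suc show ?case by (simp add: qfac_Suc right_diff_distrib fps_X_power_mult_right_nth)
qed simp

lemma qfac_conv_compose: "k > 0 \<Longrightarrow> qfac k n = fps_compose (qfac 1 n) (fps_X ^ k)"
  by (induction n)
     (simp_all add: qfac_Suc fps_compose_mult_distrib compose_one_minus_X_power
        flip: power_mult del: power_Suc)

lemma E_nth: "t \<le> n \<Longrightarrow> E_fps $ t = qfac 1 n $ t"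
proof -
  assume "t \<le> n"
  have "(\<Prod>m\<in>{1..t}. (1 - fps_X ^ m :: rat fps)) = qfac 1 t"
    unfolding qfac_def by (rule prod.reindex_bij_witness[of _ "Suc" "\<lambda>m. m - 1"]) auto
  thus ?thesis using qfac_nth_stable[of 1 t t "n - t"] \<open>t \<le> n\<close> by (simp add: E_fps_def)
qed

text \<open>The multiplier c allows lengths of several finite products to be matched so that an eta
  identity already holds exactly at each stage n; the limit is then taken on both sides.\<close>

lemma qfac_tendsto:
  assumes "k > 0" "c > 0"
  shows "(\<lambda>n. qfac k (c * n)) \<longlonglongrightarrow> dilate k E_fps"
proof -
  have "(\<lambda>n. qfac 1 (c * n)) \<longlonglongrightarrow> E_fps"
  proof (rule tendsto_fpsI)
    fix t
    show "\<forall>\<^sub>F n in sequentially. qfac 1 (c * n) $ t = E_fps $ t"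
      using eventually_ge_at_top[of t]
    proof eventually_elim
      case (elim n)
      have "n \<le> c * n" using assms by (cases c) auto
      with elim show ?case by (intro E_nth [symmetric]) linarith
    qed
  qed
  from tendsto_fps_compose[OF this, of "fps_X ^ k"] show ?thesis
    by (simp only: dilate_conv_compose[OF assms(1)] qfac_conv_compose[OF assms(1)])
qed

lemma E_nth_0: "E_fps $ 0 = 1"
  by (simp add: E_nth[of 0 0])

lemma dilate_E_nth: "k > 0 \<Longrightarrow> t \<le> n \<Longrightarrow> dilate k E_fps $ t = qfac k n $ t"
proof -
  assume k: "k > 0" and t: "t \<le> n"
  have "fps_compose E_fps (fps_X ^ k) $ t = fps_compose (qfac 1 n) (fps_X ^ k) $ t"
    unfolding fps_compose_nth using t by (intro sum.cong refl) (auto simp: E_nth[of _ n])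
  thus ?thesis using k by (simp add: dilate_conv_compose qfac_conv_compose[of k n])
qed

lemma dilate_E_nth_0 [simp]: "dilate k E_fps $ 0 = 1"
  by (simp add: dilate_nth E_nth_0)

lemma dilate_E_nonzero: "dilate k E_fps \<noteq> 0"
  using dilate_E_nth_0[of k] by (metis fps_zero_nth zero_neq_one)

text \<open>Under q -> -q a factor 1 - u of odd exponent becomes 1 + u, with (1 + u)(1 - u) = 1 -
  u^2, while factors of even exponent stay. With the lengths chosen below the finite products agree
  for every n.\<close>

lemma E_compose_minus_X:
  "fps_compose E_fps (- fps_X) * E_fps * dilate 4 E_fps = dilate 2 E_fps ^ 3"
proof (rule LIMSEQ_unique)
  let ?N = "\<lambda>n. fps_compose (qfac 1 (2 * n)) (- fps_X) * qfac 1 (2 * n) * qfac 4 (1 * n)"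
  show "?N \<longlonglongrightarrow> fps_compose E_fps (- fps_X) * E_fps * dilate 4 E_fps"
    using qfac_tendsto[of 1 2] by (intro tendsto_mult_fps tendsto_fps_compose qfac_tendsto) auto
  have "?N n = qfac 2 (2 * n) * qfac 2 (1 * n) * qfac 2 (1 * n)" for n
  proof (induction n)
    case (Suc n)
    define u v :: "rat fps" where "u = fps_X ^ (2*n+1)" and "v = fps_X ^ (2*n+2)"
    have q1: "qfac 1 (2 * Suc n) = qfac 1 (2*n) * ((1 - u) * (1 - v))"
      by (simp add: qfac_Suc u_def v_def mult.assoc del: power_Suc)
    have q2: "qfac 2 (2 * Suc n) = qfac 2 (2*n) * ((1 - u^2) * (1 - v^2))"
      by (simp add: qfac_Suc u_def v_def mult.assoc flip: power_mult del: power_Suc)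
    have q2': "qfac 2 (1 * Suc n) = qfac 2 (1 * n) * (1 - v)"
      by (simp add: qfac_Suc v_def del: power_Suc)
    have q4: "qfac 4 (1 * Suc n) = qfac 4 (1 * n) * (1 - v^2)"
      by (simp add: qfac_Suc v_def flip: power_mult del: power_Suc)
    have "(-fps_X) ^ (2*n+1) = - u" "(-fps_X) ^ (2*n+2) = v"
      unfolding u_def v_def by (rule power_minus_odd power_minus_even; simp)+
    hence "fps_compose (1 - u) (- fps_X) = 1 + u" "fps_compose (1 - v) (- fps_X) = 1 - v"
      unfolding u_def v_def by (subst compose_one_minus_X_power; simp)+
    hence q1': "fps_compose (qfac 1 (2 * Suc n)) (- fps_X) =
        fps_compose (qfac 1 (2*n)) (- fps_X) * ((1 + u) * (1 - v))"
      unfolding q1 by (subst fps_compose_mult_distrib, simp)+ simp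
    have "?N (Suc n) = ?N n * (((1 + u) * (1 - v)) * ((1 - u) * (1 - v)) * (1 - v^2))"
      unfolding q1' unfolding q1 q4 by (simp only: mult_ac)
    also have "((1 + u) * (1 - v)) * ((1 - u) * (1 - v)) * (1 - v^2) =
        ((1 - u^2) * (1 - v^2)) * ((1 - v) * (1 - v))"
      by algebra
    finally show ?case unfolding Suc q2 q2' by (simp only: mult_ac)
  qed simp
  thus "?N \<longlonglongrightarrow> dilate 2 E_fps ^ 3"
    unfolding power3_eq_cube
    by (simp only:) (intro tendsto_mult_fps qfac_tendsto; simp)
qed

section \<open>The Jacobi triple product\<close>

text \<open>The Gaussian binomial coefficient, given by its Pascal recursion to avoid division;
  \<open>qbinom_qfac\<close> is the usual quotient formula in cleared form.\<close>

fun qbinom :: "'a::comm_ring_1 \<Rightarrow> nat \<Rightarrow> nat \<Rightarrow> 'a" where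
  "qbinom q n 0 = 1"
| "qbinom q 0 (Suc k) = 0"
| "qbinom q (Suc n) (Suc k) = q ^ Suc k * qbinom q n (Suc k) + qbinom q n k"

lemma qbinom_eq_0: "k > n \<Longrightarrow> qbinom q n k = 0"
  by (induction q n k rule: qbinom.induct) auto

text \<open>Rothe's formula, kept homogeneous in x and y so that no negative power of q is needed
  later. The factor k = 0 is split off and the induction hypothesis is used at x q, hence x is
  generalised.\<close>

lemma qbinomial_theorem:
  fixes x y q :: "'a::comm_ring_1"
  shows "(\<Prod>k<n. y + x * q ^ k) = (\<Sum>k\<le>n. q ^ (k choose 2) * qbinom q n k * x ^ k * y ^ (n - k))"
proof (induction n arbitrary: x)
  case (Suc n)
  have ch: "Suc k choose 2 = k + (k choose 2)" for k
    by (simp add: numeral_2_eq_2)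
  let ?t = "\<lambda>k. q ^ (k choose 2) * q ^ k * qbinom q n k * x ^ k * y ^ (n - k)"
  have "(\<Prod>k<Suc n. y + x * q ^ k) = (y + x) * (\<Prod>k<n. y + (x * q) * q ^ k)"
    by (subst prod.lessThan_Suc_shift) (simp add: mult_ac)
  also have "(\<Prod>k<n. y + (x * q) * q ^ k) = (\<Sum>k\<le>n. ?t k)"
    unfolding Suc.IH by (intro sum.cong refl) (simp add: power_mult_distrib mult_ac)
  also have "(y + x) * (\<Sum>k\<le>n. ?t k) = (\<Sum>k\<le>n. y * ?t k) + (\<Sum>k\<le>n. x * ?t k)"
    by (subst distrib_right) (simp only: sum_distrib_left)
  also have "(\<Sum>k\<le>n. y * ?t k) = (\<Sum>k\<le>Suc n. q ^ (k choose 2) * q ^ k * qbinom q n k * x ^ k * y ^ (Suc n - k))"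
    by (simp add: qbinom_eq_0 Suc_diff_le mult_ac)
  also have "\<dots> = y ^ Suc n + (\<Sum>k\<le>n. q ^ (Suc k choose 2) * q ^ Suc k * qbinom q n (Suc k) * x ^ Suc k * y ^ (n - k))"
    by (subst sum.atMost_Suc_shift) (simp add: numeral_2_eq_2)
  also have "\<dots> + (\<Sum>k\<le>n. x * ?t k) = y ^ Suc n + (\<Sum>k\<le>n. q ^ (Suc k choose 2) * qbinom q (Suc n) (Suc k) * x ^ Suc k * y ^ (n - k))"
    by (simp add: sum.distrib [symmetric] add.assoc ch power_add ring_distribs mult_ac)
  also have "\<dots> = (\<Sum>k\<le>Suc n. q ^ (k choose 2) * qbinom q (Suc n) k * x ^ k * y ^ (Suc n - k))"
    by (subst sum.atMost_Suc_shift) (simp add: numeral_2_eq_2)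
  finally show ?case .
qed (simp add: numeral_2_eq_2)

lemma qbinom_qfac:
  "k \<le> n \<Longrightarrow> qbinom (fps_X ^ s) n k * qfac s k * qfac s (n - k) = qfac s n"
proof (induction n arbitrary: k)
  case (Suc n)
  show ?case
  proof (cases k)
    case (Suc j)
    let ?q = "\<lambda>m. fps_X ^ (s * m) :: rat fps"
    have *: "qbinom (fps_X ^ s) n j * qfac s j * qfac s (n - j) = qfac s n"
      using Suc.IH[of j] Suc Suc.prems by simp
    \<comment> \<open>For j = n both sides vanish: the binomial on the left, and 1 - q^0 on the
      right.\<close>
    have "qbinom (fps_X ^ s) n (Suc j) * qfac s (Suc j) * qfac s (n - j)
        = qfac s n * (1 - ?q (n - j))"
    proof (cases "j = n")
      case False
      hence "n - j = Suc (n - Suc j)" using Suc Suc.prems by simp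
      hence "qfac s (n - j) = qfac s (n - Suc j) * (1 - ?q (n - j))"
        by (simp only: qfac_Suc)
      with Suc.IH[of "Suc j"] False Suc Suc.prems show ?thesis
        by (simp add: mult_ac)
    qed (simp add: qbinom_eq_0)
    note ** = this
    have "qbinom (fps_X ^ s) (Suc n) k * qfac s k * qfac s (Suc n - k) =
       ?q (Suc j) * (qbinom (fps_X ^ s) n (Suc j) * qfac s (Suc j) * qfac s (n - j))
        + (qbinom (fps_X ^ s) n j * qfac s j * qfac s (n - j)) * (1 - ?q (Suc j))"
      unfolding Suc qbinom.simps diff_Suc_Suc qfac_Suc[of s j] power_mult [symmetric]
      by (simp only: distrib_right distrib_left mult_ac)
    also have "\<dots> = qfac s n * (1 - ?q (Suc j) * ?q (n - j))"
      unfolding * ** by (simp add: algebra_simps)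
    also have "?q (Suc j) * ?q (n - j) = ?q (Suc n)"
      using Suc Suc.prems by (simp flip: power_add distrib_left)
    finally show ?thesis by (simp only: qfac_Suc)
  qed simp
qed simp

lemma X_power_dvd_iff: "fps_X ^ n dvd (f :: rat fps) \<longleftrightarrow> (\<forall>t<n. f $ t = 0)"
proof
  assume "\<forall>t<n. f $ t = 0"
  hence "fps_cutoff n f = 0" by (simp add: fps_eq_iff)
  thus "fps_X ^ n dvd f" using fps_shift_cutoff'[of n f] by (metis add.right_neutral dvd_triv_left)
qed (auto simp: fps_X_power_mult_nth)

text \<open>Modulo q^(t+1) all three q-factorials in \<open>qbinom_qfac\<close> equal E(q^s). Hence
  B E^2 = E for the binomial B, and the unit E cancels.\<close>

lemma qbinom_E_nth:
  assumes s: "s > 0" and t: "t \<le> k" "t \<le> n - k" and k: "k \<le> n"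
  shows "(qbinom (fps_X ^ s) n k * dilate s E_fps) $ t = (if t = 0 then 1 else 0)"
proof -
  define E where "E = dilate s E_fps"
  define B where "B = qbinom (fps_X ^ s :: rat fps) n k"
  have dvd: "fps_X ^ Suc t dvd E - qfac s m" if "t \<le> m" for m
    unfolding X_power_dvd_iff E_def using that dilate_E_nth[OF s, of _ m] by auto
  obtain u where u: "E - qfac s k = fps_X ^ Suc t * u" using dvd[OF t(1)] by (auto elim: dvdE)
  obtain v where v: "E - qfac s (n - k) = fps_X ^ Suc t * v" using dvd[OF t(2)] by (auto elim: dvdE)
  obtain w where w: "E - qfac s n = fps_X ^ Suc t * w" using dvd[of n] t k by (auto elim: dvdE)
  \<comment> \<open>An exact expansion of B E^2 - E: the last bracket is zero by
    \<open>qbinom_qfac\<close>, and every other term contains a difference divisible by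
    q^(t+1).\<close>
  have "(B * E - 1) * E = B * (qfac s k * (E - qfac s (n - k)) + (E - qfac s k) * E) 
      - (E - qfac s n) + (B * qfac s k * qfac s (n - k) - qfac s n)"
    by (simp add: algebra_simps)
  also have "\<dots> = fps_X ^ Suc t * (B * (qfac s k * v + u * E) - w)"
    unfolding u v w B_def qbinom_qfac[OF k] by (simp add: algebra_simps)
  finally have "fps_X ^ Suc t dvd (B * E - 1) * E * inverse E"
    by (simp only: dvd_mult2 dvd_triv_left)
  moreover have "E * inverse E = 1"
    unfolding E_def by (rule inverse_mult_eq_1') simp
  ultimately have "fps_X ^ Suc t dvd B * E - 1"
    by (simp only: mult.assoc mult_1_right)
  thus ?thesis unfolding X_power_dvd_iff E_def B_def by auto
qed

definition alt_sign :: "int \<Rightarrow> rat" where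
  "alt_sign l = (if even l then 1 else -1)"

text \<open>The exponent \<open>i l(l+1)/2 + j l(l-1)/2\<close>; both halves are nonnegative integers, so
  nothing is truncated.\<close>
definition theta_exp :: "nat \<Rightarrow> nat \<Rightarrow> int \<Rightarrow> nat" where
  "theta_exp i j l = i * nat (l * (l + 1) div 2) + j * nat (l * (l - 1) div 2)"

lemma theta_exp_double:
  "2 * int (theta_exp i j l) = int i * (l * (l + 1)) + int j * (l * (l - 1))"
proof -
  have ge: "l * (l + 1) \<ge> 0" "l * (l - 1) \<ge> 0"
    unfolding zero_le_mult_iff by linarith+
  define a b where "a = l * (l + 1) div 2" and "b = l * (l - 1) div 2"
  have ab: "2 * a = l * (l + 1)" "2 * b = l * (l - 1)"
    unfolding a_def b_def by (rule dvd_mult_div_cancel; simp)+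
  with ge have "a \<ge> 0" "b \<ge> 0" by linarith+
  hence "2 * int (theta_exp i j l) = int i * (2 * a) + int j * (2 * b)"
    unfolding theta_exp_def a_def [symmetric] b_def [symmetric]
    by (simp only: of_nat_add of_nat_mult int_nat_eq if_True distrib_left mult.left_commute[of 2])
  thus ?thesis unfolding ab .
qed

text \<open>Since l^2 >= |l|, the exponent grows at least linearly. This gives finite fibres, and
  only |l| <= N can matter for coefficient N.\<close>

lemma theta_exp_ge:
  assumes "i > 0" "j > 0"
  shows "\<bar>l\<bar> \<le> int (theta_exp i j l)"
proof -
  have ge: "l * (l + 1) \<ge> 0" "l * (l - 1) \<ge> 0"
    unfolding zero_le_mult_iff by linarith+
  have "2 * \<bar>l\<bar> \<le> 2 * (l * l)"
    using mult_left_mono[of 1 "\<bar>l\<bar>" "\<bar>l\<bar>"] by (cases "l = 0") auto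
  also have "\<dots> = 1 * (l * (l + 1)) + 1 * (l * (l - 1))" by (simp add: algebra_simps)
  also have "\<dots> \<le> int i * (l * (l + 1)) + int j * (l * (l - 1))"
    using assms ge by (intro add_mono mult_right_mono) auto
  finally show ?thesis by (simp flip: theta_exp_double)
qed

lemma prod_lessThan_add:
  "(\<Prod>k<m + n. f k) = (\<Prod>k<m. f k) * (\<Prod>k<n. f (m + k :: nat) :: 'a::comm_monoid_mult)"
  by (induction n) (simp_all add: mult.assoc)

text \<open>(q^i; q^(i+j))_n (q^j; q^(i+j))_n, the truncated triple product without the factor
  E(q^(i+j)).\<close>

definition theta_prod :: "nat \<Rightarrow> nat \<Rightarrow> nat \<Rightarrow> rat fps" where
  "theta_prod i j n = (\<Prod>k<n. (1 - fps_X ^ (i + (i + j) * k)) * (1 - fps_X ^ (j + (i + j) * k)))"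

text \<open>The q-binomial theorem with 2n factors, base q^s, x = -q^i and y = q^(s n). The upper n
  factors yield the i-part of the product, the lower n, read backwards, the j-part.\<close>

lemma theta_prod_finite:
  "theta_prod i j n = (\<Sum>k\<le>2*n. (-1) ^ (n + k) * fps_X ^ theta_exp i j (int k - int n)
      * qbinom (fps_X ^ (i + j)) (2 * n) k)"
proof -
  define s where "s = i + j"
  \<comment> \<open>The total exponent of the monomials pulled out of the 2n factors: s n^2 from the
    upper half, the rest from the lower half.\<close>
  define D where "D = s * n * n + (i * n + s * (n choose 2))"
  let ?X = "fps_X :: rat fps"
  have Y: "(\<Prod>k<n. - (?X ^ (i + s * k))) = (-1) ^ n * ?X ^ (i * n + s * (n choose 2))"
    by (induction n) (simp_all add: numeral_2_eq_2 algebra_simps power_add)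
  have "(\<Prod>k<2*n. ?X ^ (s * n) + (- (?X ^ i)) * (?X ^ s) ^ k)
     = (\<Prod>k<n. ?X ^ (s * n) - ?X ^ (i + s * k)) * (\<Prod>k<n. ?X ^ (s * n) - ?X ^ (i + s * (n + k)))"
    by (simp add: mult_2 prod_lessThan_add flip: power_add power_mult)
  also have "(\<Prod>k<n. ?X ^ (s * n) - ?X ^ (i + s * (n + k))) = (\<Prod>k<n. ?X ^ (s * n) * (1 - ?X ^ (i + s * k)))"
    by (intro prod.cong refl) (simp add: algebra_simps power_add)
  also have "\<dots> = ?X ^ (s * n * n) * (\<Prod>k<n. 1 - ?X ^ (i + s * k))"
    by (simp add: prod.distrib power_mult)
  \<comment> \<open>Here the smaller power is q^(i + s k), and the exponent left over is s n - i - s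
    k = j + s (n - 1 - k).\<close>
  also have "(\<Prod>k<n. ?X ^ (s * n) - ?X ^ (i + s * k)) =
      (\<Prod>k<n. - (?X ^ (i + s * k)) * (1 - ?X ^ (j + s * (n - Suc k))))"
  proof (intro prod.cong refl)
    fix k assume "k \<in> {..<n}"
    then obtain m where "n = Suc k + m" by (auto dest: less_imp_add_positive less_imp_Suc_add)
    hence "s * n = (i + s * k) + (j + s * (n - Suc k))"
      by (simp add: s_def algebra_simps)
    hence "?X ^ (s * n) = ?X ^ (i + s * k) * ?X ^ (j + s * (n - Suc k))"
      by (simp only: power_add)
    thus "?X ^ (s * n) - ?X ^ (i + s * k) = - (?X ^ (i + s * k)) * (1 - ?X ^ (j + s * (n - Suc k)))"
      by (simp only: right_diff_distrib mult_1_right mult_minus_left) simp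
  qed
  also have "\<dots> = (-1) ^ n * ?X ^ (i * n + s * (n choose 2)) * (\<Prod>k<n. 1 - ?X ^ (j + s * k))"
    by (simp only: prod.distrib Y prod.nat_diff_reindex[of "\<lambda>k. 1 - ?X ^ (j + s * k)"])
  finally have "(\<Prod>k<2*n. ?X ^ (s * n) + (- (?X ^ i)) * (?X ^ s) ^ k)
      = ?X ^ D * ((-1) ^ n * theta_prod i j n)"
    by (simp add: theta_prod_def s_def D_def prod.distrib power_add mult_ac)
  also have "(\<Prod>k<2*n. ?X ^ (s * n) + (- (?X ^ i)) * (?X ^ s) ^ k) =
     (\<Sum>k\<le>2*n. ?X ^ D * ((-1) ^ k * ?X ^ theta_exp i j (int k - int n) * qbinom (?X ^ s) (2 * n) k))"
    unfolding qbinomial_theorem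
  proof (intro sum.cong refl)
    fix k assume k: "k \<in> {..2*n}"
    have c2: "2 * int (m choose 2) = int m * (int m - 1)" for m
      by (induction m) (simp_all add: numeral_2_eq_2 algebra_simps)
    \<comment> \<open>Doubling clears the halves in the binomials and in \<open>theta_exp\<close>,
      leaving a polynomial identity over the integers.\<close>
    have "2 * int (s * (k choose 2) + i * k + s * n * (2 * n - k)) 
        = 2 * int (D + theta_exp i j (int k - int n))"
      using k by (simp add: D_def distrib_left theta_exp_double mult.left_commute[of 2] c2 of_nat_diff)
         (simp add: s_def algebra_simps)
    hence "s * (k choose 2) + i * k + s * n * (2 * n - k) = D + theta_exp i j (int k - int n)"
      by (simp only: mult_cancel_left of_nat_eq_iff) simp
    hence "?X ^ D * ?X ^ theta_exp i j (int k - int n) = 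
      (?X ^ s) ^ (k choose 2) * (?X ^ i) ^ k * (?X ^ (s * n)) ^ (2 * n - k)"
      by (simp flip: power_add power_mult)
    thus "(?X ^ s) ^ (k choose 2) * qbinom (?X ^ s) (2 * n) k * (- (?X ^ i)) ^ k * (?X ^ (s * n)) ^ (2 * n - k)
      = ?X ^ D * ((-1) ^ k * ?X ^ theta_exp i j (int k - int n) * qbinom (?X ^ s) (2 * n) k)"
      by (simp add: power_minus[of "?X ^ i"] mult_ac)
  qed
  finally have "(-1) ^ n * theta_prod i j n = 
     (\<Sum>k\<le>2*n. (-1) ^ k * ?X ^ theta_exp i j (int k - int n) * qbinom (?X ^ s) (2 * n) k)"
    by (simp flip: sum_distrib_left)
  hence "(-1) ^ n * ((-1) ^ n * theta_prod i j n) = 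
     (\<Sum>k\<le>2*n. (-1) ^ (n + k) * ?X ^ theta_exp i j (int k - int n) * qbinom (?X ^ s) (2 * n) k)"
    by (simp add: sum_distrib_left power_add mult.assoc)
  thus ?thesis by (simp add: s_def flip: mult.assoc power_add mult_2)
qed

text \<open>The series of all w x q^(e x). An infinite fibre of e contributes 0 by the convention
  for sums over infinite sets, so products and disjoint sums below assume finite fibres.\<close>

definition gen_fun :: "('a \<Rightarrow> rat) \<Rightarrow> ('a \<Rightarrow> nat) \<Rightarrow> rat fps" where
  "gen_fun w e = Abs_fps (\<lambda>N. \<Sum>x | e x = N. w x)"

text \<open>Ramanujan's f(-q^i, -q^j).\<close>

definition theta :: "nat \<Rightarrow> nat \<Rightarrow> rat fps" where
  "theta i j = gen_fun alt_sign (theta_exp i j)"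

lemma finite_theta_exp:
  assumes "i > 0" "j > 0"
  shows "finite {l. theta_exp i j l = N}"
proof (rule finite_subset)
  show "{l. theta_exp i j l = N} \<subseteq> {- int N..int N}"
  proof
    fix l assume "l \<in> {l. theta_exp i j l = N}"
    with theta_exp_ge[OF assms, of l] show "l \<in> {- int N..int N}" by auto
  qed
qed simp

theorem jacobi_triple_product:
  assumes "i > 0" "j > 0"
  shows "(\<lambda>n. theta_prod i j n * dilate (i + j) E_fps) \<longlonglongrightarrow> theta i j"
proof (rule tendsto_fpsI)
  fix N
  show "\<forall>\<^sub>F n in sequentially. (theta_prod i j n * dilate (i + j) E_fps) $ N = theta i j $ N"
    \<comment> \<open>If n >= 2N and |k - n| <= N, then k and 2n - k are both at least N, as
      \<open>qbinom_E_nth\<close> requires.\<close>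
    using eventually_ge_at_top[of "2 * N"]
  proof eventually_elim
    case (elim n)
    define e where "e = theta_exp i j"
    define s where "s = i + j"
    let ?E = "dilate s E_fps"
    have sgn: "(-1 :: rat fps) ^ m = fps_const ((-1) ^ m)" for m
      by (metis fps_const_1_eq_1 fps_const_neg fps_const_power)
    have "(theta_prod i j n * ?E) $ N = (\<Sum>k\<le>2*n. (-1) ^ (n + k) * 
      (fps_X ^ e (int k - int n) * (qbinom (fps_X ^ s) (2 * n) k * ?E)) $ N)"
      unfolding theta_prod_finite e_def s_def sgn
      by (simp add: sum_distrib_right fps_sum_nth mult.assoc)
    also have "\<dots> = (\<Sum>k\<le>2*n. if e (int k - int n) = N then (-1) ^ (n + k) else 0)"
    proof (intro sum.cong refl)
      fix k assume k: "k \<in> {..2*n}"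
      show "(-1) ^ (n + k) * (fps_X ^ e (int k - int n) * (qbinom (fps_X ^ s) (2 * n) k * ?E)) $ N
        = (if e (int k - int n) = N then (-1) ^ (n + k) else 0)"
      proof (cases "e (int k - int n) \<le> N")
        case True
        have "\<bar>int k - int n\<bar> \<le> int N"
          using theta_exp_ge[OF assms, of "int k - int n"] True by (simp add: e_def)
        hence "(qbinom (fps_X ^ s) (2 * n) k * ?E) $ (N - e (int k - int n)) =
            (if N - e (int k - int n) = 0 then 1 else 0)"
          using k elim assms by (intro qbinom_E_nth) (auto simp: s_def)
        with True show ?thesis by (simp only: fps_X_power_mult_nth) auto
      qed (simp add: fps_X_power_mult_nth)
    qed
    also have "\<dots> = (\<Sum>k | k \<in> {..2*n} \<and> e (int k - int n) = N. (-1) ^ (n + k))"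
      by (rule sum.inter_filter [symmetric]) simp
    also have "\<dots> = (\<Sum>l | e l = N. alt_sign l)"
    proof (rule sum.reindex_bij_witness[of _ "\<lambda>l. nat (l + int n)" "\<lambda>k. int k - int n"])
      fix l assume "l \<in> {l. e l = N}"
      hence "\<bar>l\<bar> \<le> int N" using theta_exp_ge[OF assms, of l] by (auto simp: e_def)
      hence l: "- int n \<le> l" "l \<le> int n" using elim by auto
      thus "int (nat (l + int n)) - int n = l" by simp
      with l \<open>l \<in> {l. e l = N}\<close> show "nat (l + int n) \<in> {k \<in> {..2*n}. e (int k - int n) = N}" by auto
    next
      fix k assume "k \<in> {k \<in> {..2*n}. e (int k - int n) = N}"
      show "alt_sign (int k - int n) = (-1) ^ (n + k)"
        by (cases "even (n + k)") (auto simp: alt_sign_def)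
    qed auto
    finally show ?case by (simp add: theta_def gen_fun_def e_def s_def)
  qed
qed

lemma theta_prod_0 [simp]: "theta_prod i j 0 = 1"
  and theta_prod_Suc: "theta_prod i j (Suc n) = theta_prod i j n *
    ((1 - fps_X ^ (i + (i + j) * n)) * (1 - fps_X ^ (j + (i + j) * n)))"
  by (simp_all add: theta_prod_def)

text \<open>With E(q^(i+j)) truncated as well, each stage is a finite product that can be compared
  factor by factor with finite eta products.\<close>

lemma jacobi_triple_product_qfac:
  assumes "i > 0" "j > 0"
  shows "(\<lambda>n. theta_prod i j n * qfac (i + j) (1 * n)) \<longlonglongrightarrow> theta i j"
proof -
  let ?E = "dilate (i + j) E_fps"
  have inv: "?E * inverse ?E = 1"
    by (rule inverse_mult_eq_1') simp
  have "(\<lambda>n. theta_prod i j n * ?E * inverse ?E * qfac (i + j) (1 * n)) \<longlonglongrightarrow> theta i j * inverse ?E * ?E"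
    using assms by (intro tendsto_mult_fps jacobi_triple_product qfac_tendsto tendsto_const) auto
  thus ?thesis using inv by (simp only: mult.assoc mult.commute[of "inverse ?E"] mult_1_left mult_1_right)
qed

section \<open>Three theta series as eta quotients\<close>

lemma theta_1_1: "theta 1 1 * dilate 2 E_fps = E_fps ^ 2"
proof (rule LIMSEQ_unique)
  let ?N = "\<lambda>n. qfac 1 (2 * n) * qfac 1 (2 * n)"
  let ?T = "\<lambda>n. theta_prod 1 1 n * qfac (1 + 1) (1 * n) * qfac 2 (1 * n)"
  show "?N \<longlonglongrightarrow> E_fps ^ 2"
    unfolding power2_eq_square using qfac_tendsto[of 1 2] by (intro tendsto_mult_fps) auto
  have "?N n = ?T n" for n
  proof (induction n)
    case (Suc n)
    define f where "f = (\<lambda>k. 1 - fps_X ^ (2 * n + k) :: rat fps)"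
    have eqs: "2 * Suc n = Suc (Suc (2 * n))" "1 * Suc n = Suc (1 * n)"
      "1 * Suc (2 * n) = 2 * n + 1" "1 * Suc (Suc (2 * n)) = 2 * n + 2"
      "(1 + 1) * Suc (1 * n) = 2 * n + 2" "2 * Suc (1 * n) = 2 * n + 2"
      "1 + (1 + 1) * n = 2 * n + 1"
      by auto
    have "?N (Suc n) = ?N n * (f 1 * f 2) * (f 1 * f 2)"
      unfolding eqs(1) qfac_Suc eqs by (simp only: f_def mult_ac)
    also have "\<dots> = ?T (Suc n)"
      unfolding Suc eqs(2) qfac_Suc theta_prod_Suc eqs by (simp only: f_def mult_ac)
    finally show ?case .
  qed simp
  moreover have "?T \<longlonglongrightarrow> theta 1 1 * dilate 2 E_fps"
    by (intro tendsto_mult_fps jacobi_triple_product_qfac qfac_tendsto) auto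
  ultimately show "?N \<longlonglongrightarrow> theta 1 1 * dilate 2 E_fps" by presburger
qed

text \<open>Euler's pentagonal number theorem: the exponents 3n+1, 3n+2, 3n+3 together run through
  all positive integers.\<close>

lemma theta_1_2: "theta 1 2 = E_fps"
proof (rule LIMSEQ_unique)
  let ?N = "\<lambda>n. qfac 1 (3 * n)"
  let ?T = "\<lambda>n. theta_prod 1 2 n * qfac (1 + 2) (1 * n)"
  show "?N \<longlonglongrightarrow> E_fps"
    using qfac_tendsto[of 1 3] by auto
  have "?N n = ?T n" for n
  proof (induction n)
    case (Suc n)
    define f where "f = (\<lambda>k. 1 - fps_X ^ (3 * n + k) :: rat fps)"
    have eqs: "3 * Suc n = Suc (Suc (Suc (3 * n)))" "1 * Suc n = Suc (1 * n)"
      "1 * Suc (3 * n) = 3 * n + 1" "1 * Suc (Suc (3 * n)) = 3 * n + 2"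
      "1 * Suc (Suc (Suc (3 * n))) = 3 * n + 3"
      "(1 + 2) * Suc (1 * n) = 3 * n + 3"
      "1 + (1 + 2) * n = 3 * n + 1" "2 + (1 + 2) * n = 3 * n + 2"
      by auto
    have "?N (Suc n) = ?N n * (f 1 * f 2 * f 3)"
      unfolding eqs(1) qfac_Suc eqs by (simp only: f_def mult_ac)
    also have "\<dots> = ?T (Suc n)"
      unfolding Suc eqs(2) qfac_Suc theta_prod_Suc eqs by (simp only: f_def mult_ac)
    finally show ?case .
  qed simp
  moreover have "?T \<longlonglongrightarrow> theta 1 2"
    by (intro jacobi_triple_product_qfac) auto
  ultimately show "?N \<longlonglongrightarrow> theta 1 2" by presburger
qed

text \<open>The exponents 1 and 5 modulo 6 are those prime to 6: multiples of 2 and of 3 are removed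
  from E(q), and multiples of 6, removed twice, are restored. The second factor E(q^6) comes from
  the triple product.\<close>

lemma theta_1_5: "theta 1 5 * dilate 2 E_fps * dilate 3 E_fps = E_fps * dilate 6 E_fps ^ 2"
proof (rule LIMSEQ_unique)
  let ?N = "\<lambda>n. qfac 1 (6 * n) * (qfac 6 (1 * n) * qfac 6 (1 * n))"
  let ?T = "\<lambda>n. theta_prod 1 5 n * qfac (1 + 5) (1 * n) * qfac 2 (3 * n) * qfac 3 (2 * n)"
  show "?N \<longlonglongrightarrow> E_fps * dilate 6 E_fps ^ 2"
    unfolding power2_eq_square using qfac_tendsto[of 1 6] 
    by (intro tendsto_mult_fps qfac_tendsto) auto
  have "?N n = ?T n" for n
  proof (induction n)
    case (Suc n)
    \<comment> \<open>f k is the factor of exponent 6n + k. Once all exponents have this form, both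
      increments are the same multiset of factors.\<close>
    define f where "f = (\<lambda>k. 1 - fps_X ^ (6 * n + k) :: rat fps)"
    have eqs: "6 * Suc n = Suc (Suc (Suc (Suc (Suc (Suc (6 * n))))))" "1 * Suc n = Suc (1 * n)"
      "2 * Suc n = Suc (Suc (2 * n))" "3 * Suc n = Suc (Suc (Suc (3 * n)))"
      "1 * Suc (6 * n) = 6 * n + 1" "1 * Suc (Suc (6 * n)) = 6 * n + 2"
      "1 * Suc (Suc (Suc (6 * n))) = 6 * n + 3" "1 * Suc (Suc (Suc (Suc (6 * n)))) = 6 * n + 4"
      "1 * Suc (Suc (Suc (Suc (Suc (6 * n))))) = 6 * n + 5"
      "1 * Suc (Suc (Suc (Suc (Suc (Suc (6 * n)))))) = 6 * n + 6"
      "2 * Suc (3 * n) = 6 * n + 2" "2 * Suc (Suc (3 * n)) = 6 * n + 4"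
      "2 * Suc (Suc (Suc (3 * n))) = 6 * n + 6"
      "3 * Suc (2 * n) = 6 * n + 3" "3 * Suc (Suc (2 * n)) = 6 * n + 6"
      "(1 + 5) * Suc (1 * n) = 6 * n + 6" "6 * Suc (1 * n) = 6 * n + 6"
      "1 + (1 + 5) * n = 6 * n + 1" "5 + (1 + 5) * n = 6 * n + 5"
      by auto
    have "?N (Suc n) = ?N n * (f 1 * f 2 * f 3 * f 4 * f 5 * f 6 * (f 6 * f 6))"
      unfolding eqs(1,2) qfac_Suc eqs(5-) by (simp only: f_def mult_ac)
    also have "\<dots> = ?T (Suc n)"
      unfolding Suc eqs(2-4) qfac_Suc theta_prod_Suc eqs(5-) by (simp only: f_def mult_ac)
    finally show ?case .
  qed simp
  moreover have "?T \<longlonglongrightarrow> theta 1 5 * dilate 2 E_fps * dilate 3 E_fps"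
    by (intro tendsto_mult_fps jacobi_triple_product_qfac qfac_tendsto) auto
  ultimately show "?N \<longlonglongrightarrow> theta 1 5 * dilate 2 E_fps * dilate 3 E_fps" by presburger
qed

section \<open>The 2-dissection\<close>

lemma gen_fun_mult:
  assumes "\<And>N. finite {x. e x = N}" "\<And>N. finite {y. e' y = N}"
  shows "gen_fun w e * gen_fun w' e' = gen_fun (\<lambda>(x, y). w x * w' y) (\<lambda>(x, y). e x + e' y)"
proof (rule fps_ext)
  fix N
  have "(gen_fun w e * gen_fun w' e') $ N = 
    (\<Sum>k\<in>{0..N}. \<Sum>(x, y)\<in>{x. e x = k} \<times> {y. e' y = N - k}. w x * w' y)"
    by (simp add: gen_fun_def fps_mult_nth sum_product sum.cartesian_product)
  also have "\<dots> = (\<Sum>(x, y)\<in>(\<Union>k\<in>{0..N}. {x. e x = k} \<times> {y. e' y = N - k}). w x * w' y)"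
    using assms by (intro sum.UNION_disjoint [symmetric]) auto
  also have "(\<Union>k\<in>{0..N}. {x. e x = k} \<times> {y. e' y = N - k}) = {(x, y). e x + e' y = N}"
    by force
  finally show "(gen_fun w e * gen_fun w' e') $ N = 
      gen_fun (\<lambda>(x, y). w x * w' y) (\<lambda>(x, y). e x + e' y) $ N"
    by (simp add: gen_fun_def case_prod_unfold)
qed

lemma gen_fun_bij:
  assumes "bij h" shows "gen_fun (w \<circ> h) (e \<circ> h) = gen_fun w e"
proof (rule fps_ext)
  fix N
  have "bij_betw h {x. e (h x) = N} {y. e y = N}"
  proof (rule bij_betw_subset[OF assms, simplified])
    show "h ` {x. e (h x) = N} = {y. e y = N}"
      using bij_is_surj[OF assms] by (auto simp: image_iff)
  qed
  from sum.reindex_bij_betw[OF this, of w] show "gen_fun (w \<circ> h) (e \<circ> h) $ N = gen_fun w e $ N"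
    by (simp add: gen_fun_def)
qed

lemma gen_fun_sum:
  assumes "\<And>N. finite {x. e x = N}" "\<And>N. finite {y. e' y = N}"
  shows "gen_fun (case_sum w w') (case_sum e e') = gen_fun w e + gen_fun w' e'"
proof (rule fps_ext)
  fix N
  have "{x. case_sum e e' x = N} = Inl ` {x. e x = N} \<union> Inr ` {y. e' y = N}"
    by (auto simp: image_iff split: sum.splits) (metis sum.exhaust sum.case)+
  hence "sum (case_sum w w') {x. case_sum e e' x = N} = 
      sum (case_sum w w') (Inl ` {x. e x = N}) + sum (case_sum w w') (Inr ` {y. e' y = N})"
    using assms by (simp only:) (intro sum.union_disjoint; auto)
  thus "gen_fun (case_sum w w') (case_sum e e') $ N = (gen_fun w e + gen_fun w' e') $ N"
    by (simp add: gen_fun_def sum.reindex)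
qed

lemma X_power_mult_gen_fun: "fps_X ^ k * gen_fun w e = gen_fun w (\<lambda>x. e x + k)"
proof (rule fps_ext)
  fix N
  have "k \<le> N \<Longrightarrow> {x. e x = N - k} = {x. e x + k = N}" "N < k \<Longrightarrow> {x. e x + k = N} = {}" by auto
  thus "(fps_X ^ k * gen_fun w e) $ N = gen_fun w (\<lambda>x. e x + k) $ N"
    by (simp add: gen_fun_def fps_X_power_mult_nth)
qed

lemma dilate_gen_fun:
  assumes "k > 0" shows "dilate k (gen_fun w e) = gen_fun w (\<lambda>x. k * e x)"
proof (rule fps_ext)
  fix N
  have "k dvd N \<Longrightarrow> {x. e x = N div k} = {x. k * e x = N}" "\<not> k dvd N \<Longrightarrow> {x. k * e x = N} = {}" 
    using assms by auto
  thus "dilate k (gen_fun w e) $ N = gen_fun w (\<lambda>x. k * e x) $ N"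
    by (simp add: gen_fun_def dilate_nth)
qed

lemma gen_fun_compose_minus_X:
  "fps_compose (gen_fun w e) (- fps_X) = gen_fun (\<lambda>x. (-1) ^ e x * w x) e"
  by (rule fps_ext) (auto simp: gen_fun_def compose_minus_X_nth sum_distrib_left intro!: sum.cong)

text \<open>The two summands cover the pairs of equal and of opposite parity; both parametrisations
  diagonalise the form \<open>3n\<^sup>2 - 2n + 3m\<^sup>2\<close>.\<close>
definition lattice_split :: "int \<times> int + int \<times> int \<Rightarrow> int \<times> int" where
  "lattice_split = case_sum (\<lambda>(a, b). (a + b, a - b)) (\<lambda>(a, b). (1 - a - b, a - b))"

lemma bij_lattice_split: "bij lattice_split"
proof (rule bijI')
  fix p p' show "lattice_split p = lattice_split p' \<longleftrightarrow> p = p'"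
    by (cases p; cases p') (auto simp: lattice_split_def; presburger)+
next
  fix y :: "int \<times> int"
  obtain n m where y: "y = (n, m)" by (cases y)
  show "\<exists>p. y = lattice_split p"
  proof (cases "even (n + m)")
    case True
    then obtain a where "n + m = 2 * a" by (elim evenE)
    hence "y = lattice_split (Inl (a, a - m))" by (simp add: lattice_split_def y)
    thus ?thesis ..
  next
    case False
    hence "even (1 - n + m)" by auto
    then obtain a where "1 - n + m = 2 * a" by (elim evenE)
    hence "y = lattice_split (Inr (a, a - m))" by (simp add: lattice_split_def y)
    thus ?thesis ..
  qed
qed

lemma theta_product_dissection:
  "fps_compose (theta 1 5) (- fps_X) * dilate 3 (theta 1 1)
     = dilate 4 (theta 1 2) ^ 2 + fps_X * dilate 2 (theta 1 5) ^ 2"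
proof -
  let ?e5 = "theta_exp 1 5" and ?e1 = "\<lambda>m. 3 * theta_exp 1 1 m"
  have e15: "int (theta_exp 1 5 l) = 3 * l * l - 2 * l" for l
    using theta_exp_double[of 1 5 l] by (simp add: algebra_simps)
  have e11: "int (theta_exp 1 1 l) = l * l" for l
    using theta_exp_double[of 1 1 l] by (simp add: algebra_simps)
  have e12: "2 * int (theta_exp 1 2 l) = 3 * l * l - l" for l
    using theta_exp_double[of 1 2 l] by (simp add: algebra_simps)
  have fin: "finite {l. k * theta_exp 1 j l = N}" if "j > 0" "k > 0" for j k N
  proof (rule finite_subset)
    show "{l. k * theta_exp 1 j l = N} \<subseteq> {l. theta_exp 1 j l = N div k}" using that by auto
  qed (use finite_theta_exp that in auto)
  have fin2: "finite {p. (\<lambda>(x, y). e x + e' y) p = N}" 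
    if "\<And>N. finite {x. e x = N}" "\<And>N. finite {y. e' y = N}" for N :: nat and e e' :: "int \<Rightarrow> nat"
  proof (rule finite_subset)
    show "{p. (\<lambda>(x, y). e x + e' y) p = N} \<subseteq> (\<Union>k\<le>N. {x. e x = k}) \<times> (\<Union>k\<le>N. {x. e' x = k})" by auto
  qed (use that in auto)
  have sq: "dilate k (theta 1 j) ^ 2 = gen_fun (\<lambda>(a, b). alt_sign a * alt_sign b)
       (\<lambda>(a, b). k * theta_exp 1 j a + k * theta_exp 1 j b)" if "j > 0" "k > 0" for j k
    unfolding power2_eq_square theta_def dilate_gen_fun[OF \<open>k > 0\<close>]
    by (rule gen_fun_mult) (use fin that in auto)
  \<comment> \<open>Since 3 l^2 - 2 l has the parity of l, the substitution q -> -q cancels the sign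
    in \<open>theta 1 5\<close>.\<close>
  have "even (theta_exp 1 5 l) \<longleftrightarrow> even l" for l
  proof -
    have "even (int (theta_exp 1 5 l)) \<longleftrightarrow> even l" unfolding e15 by simp
    thus ?thesis by simp
  qed
  hence "(-1) ^ theta_exp 1 5 l * alt_sign l = 1" for l by (simp add: alt_sign_def uminus_power_if)
  hence "fps_compose (theta 1 5) (- fps_X) * dilate 3 (theta 1 1) = gen_fun (\<lambda>_. 1) ?e5 * gen_fun alt_sign ?e1"
    by (simp add: theta_def gen_fun_compose_minus_X dilate_gen_fun)
  also have "\<dots> = gen_fun (\<lambda>(n, m). 1 * alt_sign m) (\<lambda>(n, m). ?e5 n + ?e1 m)"
    using fin[of 5 1] fin[of 1 3] by (intro gen_fun_mult) auto
  also have "\<dots> = gen_fun ((\<lambda>(n, m). 1 * alt_sign m) \<circ> lattice_split) ((\<lambda>(n, m). ?e5 n + ?e1 m) \<circ> lattice_split)"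
    by (rule gen_fun_bij [symmetric, OF bij_lattice_split])
  also have "(\<lambda>(n, m). 1 * alt_sign m) \<circ> lattice_split = case_sum (\<lambda>(a, b). alt_sign a * alt_sign b) (\<lambda>(a, b). alt_sign a * alt_sign b)"
    by (auto simp: fun_eq_iff lattice_split_def alt_sign_def split: sum.splits)
  also have "(\<lambda>(n, m). ?e5 n + ?e1 m) \<circ> lattice_split = 
     case_sum (\<lambda>(a, b). 4 * theta_exp 1 2 a + 4 * theta_exp 1 2 b)
         (\<lambda>p. (\<lambda>(a, b). 2 * theta_exp 1 5 a + 2 * theta_exp 1 5 b) p + 1)"
  proof (rule ext)
    fix p
    \<comment> \<open>Pairs of equal parity: the cross terms cancel, leaving 6a^2 - 2a + 6b^2 - 2b,
      four times two pentagonal exponents.\<close>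
    have 1: "?e5 (a + b) + ?e1 (a - b) = 4 * theta_exp 1 2 a + 4 * theta_exp 1 2 b" for a b
    proof -
      have "int (?e5 (a + b) + ?e1 (a - b)) = int (4 * theta_exp 1 2 a + 4 * theta_exp 1 2 b)"
        using e12[of a] e12[of b] by (simp add: e15[simplified] e11[simplified] algebra_simps)
      thus ?thesis by linarith
    qed
    \<comment> \<open>Pairs of opposite parity: the form becomes 6a^2 - 4a + 6b^2 - 4b + 1, and the
      1 produces the odd factor q.\<close>
    have 2: "?e5 (1 - a - b) + ?e1 (a - b) = 2 * theta_exp 1 5 a + 2 * theta_exp 1 5 b + 1" for a b
    proof -
      have "int (?e5 (1 - a - b) + ?e1 (a - b)) = int (2 * theta_exp 1 5 a + 2 * theta_exp 1 5 b + 1)"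
        by (simp add: e15[simplified] e11[simplified] algebra_simps)
      thus ?thesis by linarith
    qed
    show "((\<lambda>(n, m). ?e5 n + ?e1 m) \<circ> lattice_split) p = 
     case_sum (\<lambda>(a, b). 4 * theta_exp 1 2 a + 4 * theta_exp 1 2 b)
         (\<lambda>p. (\<lambda>(a, b). 2 * theta_exp 1 5 a + 2 * theta_exp 1 5 b) p + 1) p"
      by (cases p) (auto simp only: lattice_split_def o_def sum.case prod.case 1 2 split: prod.splits)
  qed
  also have "gen_fun (case_sum (\<lambda>(a, b). alt_sign a * alt_sign b) (\<lambda>(a, b). alt_sign a * alt_sign b)) \<dots> =
      dilate 4 (theta 1 2) ^ 2 + fps_X ^ 1 * dilate 2 (theta 1 5) ^ 2"
    unfolding sq[where j = 2 and k = 4, OF zero_less_numeral zero_less_numeral]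
      sq[where j = 5 and k = 2, OF zero_less_numeral zero_less_numeral] X_power_mult_gen_fun
  proof (rule gen_fun_sum)
    show "finite {p. (\<lambda>(a, b). 4 * theta_exp 1 2 a + 4 * theta_exp 1 2 b) p = N}" for N
      by (rule fin2) (use fin in auto)
    show "finite {p. (\<lambda>(a, b). 2 * theta_exp 1 5 a + 2 * theta_exp 1 5 b) p + 1 = N}" for N
    \<comment> \<open>For N = 0 the truncated N - 1 is 0, but the set to be covered is then
      empty.\<close>
    proof (rule finite_subset)
      show "finite {p. (\<lambda>(a, b). 2 * theta_exp 1 5 a + 2 * theta_exp 1 5 b) p = N - 1}"
        by (rule fin2) (use fin in auto)
    qed auto
  qed
  finally show ?thesis by simp
qed

section \<open>The quadratic equation of kappa over xi(q^2)\<close>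

text \<open>\<open>ek\<close> stands for \<open>E(q^k)\<close>, and \<open>m1\<close>, \<open>m3\<close> for \<open>E(-q)\<close>, \<open>E(-q^3)\<close>.\<close>
lemma dissection_field:
  fixes e1 e2 e3 e4 e6 e12 m1 m3 F F' P P' g x :: "'a::field"
  assumes nz: "e1 \<noteq> 0" "e2 \<noteq> 0" "e3 \<noteq> 0" "e4 \<noteq> 0" "e6 \<noteq> 0" "e12 \<noteq> 0"
    and m1: "m1 * e1 * e4 = e2 ^ 3" and m3: "m3 * e3 * e12 = e6 ^ 3"
    and F: "F * e2 * m3 = m1 * e6 ^ 2" and F': "F' * e2 * e3 = e1 * e6 ^ 2"
    and P: "P * e6 = e3 ^ 2" and P': "P' * e6 = m3 ^ 2"
    and FP: "F * P = e4 ^ 2 + x * g ^ 2" and FP': "F' * P' = e4 ^ 2 - x * g ^ 2"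
  shows "e3 ^ 3 / e1 + m3 ^ 3 / m1 = 2 * (e4 ^ 3 * e6 ^ 2 / (e2 ^ 2 * e12))"
proof -
  \<comment> \<open>K is even, and K F P = G = e3^3/e1 turns the dissection of F P into one of
    G.\<close>
  define K where "K = e4 * e6 ^ 2 / (e2 ^ 2 * e12)"
  have m1': "m1 = e2 ^ 3 / (e1 * e4)" and m3': "m3 = e6 ^ 3 / (e3 * e12)"
    using nz m1 m3 by (simp_all add: field_simps)
  have m0: "m1 \<noteq> 0" "m3 \<noteq> 0" using nz by (simp_all add: m1' m3')
  have FP_eq: "F = m1 * e6 ^ 2 / (e2 * m3)" "P = e3 ^ 2 / e6"
    using nz m0 F P by (simp_all add: field_simps)
  have G: "e3 ^ 3 / e1 = K * (F * P)"
    unfolding FP_eq m1' m3' using nz by (simp add: K_def power2_eq_square power3_eq_cube divide_simps)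
  have FP_eq': "F' = e1 * e6 ^ 2 / (e2 * e3)" "P' = m3 ^ 2 / e6"
    using nz m0 F' P' by (simp_all add: field_simps)
  have G': "m3 ^ 3 / m1 = K * (F' * P')"
    unfolding FP_eq' m1' m3' using nz by (simp add: K_def power2_eq_square power3_eq_cube divide_simps)
  \<comment> \<open>The odd parts x g^2 cancel in the sum.\<close>
  have "e3 ^ 3 / e1 + m3 ^ 3 / m1 = 2 * (K * e4 ^ 2)"
    unfolding G G' FP FP' by (simp add: algebra_simps)
  also have "K * e4 ^ 2 = e4 ^ 3 * e6 ^ 2 / (e2 ^ 2 * e12)"
    by (simp add: K_def power2_eq_square power3_eq_cube)
  finally show ?thesis .
qed

text \<open>The arguments of k are the two non-even ingredients of kappa, so k e1 e3 is kappa(q) and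
  k m1 m3 is kappa(-q). All follows from G + G' = 2A, y G G' = A^2 and C A^5 = y^5.\<close>

lemma quadratic_field:
  fixes e1 e2 e3 e4 e6 e12 m1 m3 y :: "'a::field"
  assumes nz: "e1 \<noteq> 0" "e2 \<noteq> 0" "e3 \<noteq> 0" "e4 \<noteq> 0" "e6 \<noteq> 0" "e12 \<noteq> 0"
    and m1: "m1 * e1 * e4 = e2 ^ 3" and m3: "m3 * e3 * e12 = e6 ^ 3"
    and S: "e3 ^ 3 / e1 + m3 ^ 3 / m1 = 2 * (e4 ^ 3 * e6 ^ 2 / (e2 ^ 2 * e12))"
  defines "y \<equiv> e4 ^ 5 * e12 / (e2 * e6 ^ 5)"
    and "k \<equiv> (\<lambda>a b. (e2 ^ 5 * e4 ^ 5 * e12 ^ 5 / e6 ^ 15) ^ 2 / (a ^ 5 * e2 ^ 5 * e6 ^ 5 / b ^ 15))"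
  shows "k e1 e3 + k m1 m3 = 2 * y ^ 3 * (16 * y ^ 2 - 20 * y + 5)"
    and "k e1 e3 * k m1 m3 = y ^ 5"
proof -
  define C where "C = e2 ^ 5 * e4 ^ 10 * e12 ^ 10 / e6 ^ 35"
  define A where "A = e4 ^ 3 * e6 ^ 2 / (e2 ^ 2 * e12)"
  define G where "G = e3 ^ 3 / e1"
  define G' where "G' = m3 ^ 3 / m1"
  have m1': "m1 = e2 ^ 3 / (e1 * e4)" and m3': "m3 = e6 ^ 3 / (e3 * e12)"
    using nz m1 m3 by (simp_all add: field_simps)
  have m0: "m1 \<noteq> 0" "m3 \<noteq> 0" using nz by (simp_all add: m1' m3')
  have y0: "y \<noteq> 0" using nz by (simp add: y_def)
  have k: "k a b = C * (b ^ 3 / a) ^ 5" if "a \<noteq> 0" "b \<noteq> 0" for a b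
    using that nz by (simp add: k_def C_def power_mult_distrib power_divide divide_simps flip: power_mult) algebra
  have kG: "k e1 e3 = C * G ^ 5" "k m1 m3 = C * G' ^ 5"
    using k nz m0 by (simp_all add: G_def G'_def)
  have GG': "G * G' = e6 ^ 9 * e4 / (e12 ^ 3 * e2 ^ 3)"
    using nz by (simp add: G_def G'_def m1' m3' power_mult_distrib power_divide divide_simps flip: power_mult power_add)
  have AG: "y * (G * G') = A ^ 2"
    unfolding GG' using nz by (simp add: y_def A_def power_mult_distrib power_divide divide_simps flip: power_mult power_add) algebra
  have CA: "C * A ^ 5 = y ^ 5"
    using nz by (simp add: C_def y_def A_def power_mult_distrib power_divide divide_simps flip: power_mult power_add) algebra
  have S': "G + G' = 2 * A" using S by (simp add: G_def G'_def A_def)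
  \<comment> \<open>The fifth power sum is quadratic in G G'; the factor y^2 makes G G' occur only
    as y G G' = A^2.\<close>
  have "y ^ 2 * (k e1 e3 + k m1 m3) = C * (y ^ 2 * (G ^ 5 + G' ^ 5))"
    by (simp add: kG algebra_simps)
  also have "G ^ 5 + G' ^ 5 = (G + G') ^ 5 - 5 * (G + G') ^ 3 * (G * G') + 5 * (G + G') * (G * G') ^ 2"
    by algebra
  also have "y ^ 2 * \<dots> = y ^ 2 * (G + G') ^ 5 - 5 * y * (G + G') ^ 3 * (y * (G * G'))
      + 5 * (G + G') * (y * (G * G')) ^ 2"
    by algebra
  also have "C * \<dots> = (C * A ^ 5) * (2 * (16 * y ^ 2 - 20 * y + 5))"
    unfolding AG S' by algebra
  also have "\<dots> = y ^ 2 * (2 * y ^ 3 * (16 * y ^ 2 - 20 * y + 5))"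
    unfolding CA by algebra
  finally show "k e1 e3 + k m1 m3 = 2 * y ^ 3 * (16 * y ^ 2 - 20 * y + 5)"
    using y0 by simp
  have "y ^ 5 * (k e1 e3 * k m1 m3) = (C * A ^ 5) ^ 2"
  proof -
    have "y ^ 5 * (k e1 e3 * k m1 m3) = C ^ 2 * (y * (G * G')) ^ 5"
      unfolding kG by algebra
    thus ?thesis unfolding AG by algebra
  qed
  also have "\<dots> = y ^ 5 * y ^ 5" unfolding CA by algebra
  finally show "k e1 e3 * k m1 m3 = y ^ 5"
    by (rule mult_left_cancel[THEN iffD1, rotated]) (use y0 in simp)
qed

text \<open>Power series units keep their inverse in the field of Laurent series, so identities of
  eta quotients can be computed there as fractions.\<close>

lemma fps_to_fls_inverse:
  fixes f :: "'a::field fps"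
  shows "f $ 0 \<noteq> 0 \<Longrightarrow> fps_to_fls (inverse f) = inverse (fps_to_fls f)"
  by (simp add: fls_inverse_fps_to_fls subdegree_eq_0_iff)

lemma kappa_conjugate:
  fixes y k' :: "rat fps"
  defines "y \<equiv> dilate 2 xi_fps" and "k' \<equiv> fps_compose kappa_fps (- fps_X)"
  shows "kappa_fps + k' = 2 * y ^ 3 * (16 * y ^ 2 - 20 * y + 5)"
    and "kappa_fps * k' = y ^ 5"
proof -
  define e where "e = (\<lambda>k. dilate k E_fps)"
  define m where "m = fps_compose E_fps (- fps_X)"
  define L where "L = (fps_to_fls :: rat fps \<Rightarrow> _)"
  have L_mult: "L (f * g) = L f * L g" and L_pow: "L (f ^ n) = L f ^ n" and L_add: "L (f + g) = L f + L g"
    and L_diff: "L (f - g) = L f - L g" and L_eq: "L f = L g \<longleftrightarrow> f = g" and L_0: "L f \<noteq> 0 \<longleftrightarrow> f \<noteq> 0" for f g n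
    by (simp_all add: L_def fls_times_fps_to_fls fps_to_fls_power)
  have L_inv: "L (inverse f) = inverse (L f)" if "f $ 0 \<noteq> 0" for f
    using that by (simp add: L_def fps_to_fls_inverse)
  have e0: "e k $ 0 = 1" "e k \<noteq> 0" for k by (simp_all add: e_def dilate_E_nonzero)
  have m0: "m $ 0 = 1" by (simp add: m_def E_nth_0)
  have neg_mult: "fps_compose (f * g) (- fps_X) = fps_compose f (- fps_X) * fps_compose g (- fps_X)"
    and neg_pow: "fps_compose (f ^ n) (- fps_X) = fps_compose f (- fps_X) ^ n" for f g :: "rat fps" and n
    by (simp_all add: fps_compose_mult_distrib fps_compose_power)
  have neg_even: "fps_compose (e k) (- fps_X) = e k" if "even k" for k
    using that by (simp add: e_def dilate_even_compose_minus_X)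
  have neg_e3: "fps_compose (e 3) (- fps_X) = dilate 3 m"
    by (simp add: e_def m_def dilate_odd_compose_minus_X)
  have dil: "dilate k (e l) = e (k * l)" if "k > 0" for k l
    using that by (simp add: e_def dilate_dilate)
  have e1: "e (Suc 0) = E_fps" by (simp add: e_def)
  have m1: "m * e 1 * e 4 = e 2 ^ 3"
    using E_compose_minus_X by (simp add: e_def m_def)
  \<comment> \<open>The same identity at q^3.\<close>
  from arg_cong[OF this, of "dilate 3"] have m3: "dilate 3 m * e 3 * e 12 = e 6 ^ 3"
    by (simp add: dilate_mult dilate_power dil)
  define F where "F = fps_compose (theta 1 5) (- fps_X)"
  define P where "P = dilate 3 (theta 1 1)"
  define P' where "P' = dilate 3 (fps_compose (theta 1 1) (- fps_X))"
  define g where "g = dilate 2 (theta 1 5)"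
  have F': "theta 1 5 * e 2 * e 3 = e 1 * e 6 ^ 2"
    using theta_1_5 by (simp add: e_def)
  from arg_cong[OF this, of "\<lambda>f. fps_compose f (- fps_X)"]
  have F: "F * e 2 * dilate 3 m = m * e 6 ^ 2"
    by (simp add: neg_mult neg_pow neg_even neg_e3 F_def m_def e1)
  have "theta 1 1 * e 2 = e 1 ^ 2"
    using theta_1_1 by (simp add: e_def)
  from arg_cong[OF this, of "dilate 3"] have P: "P * e 6 = e 3 ^ 2"
    by (simp add: dilate_mult dilate_power dil P_def)
  from arg_cong[OF this, of "\<lambda>f. fps_compose f (- fps_X)"]
  have P': "P' * e 6 = dilate 3 m ^ 2"
    by (simp add: neg_mult neg_pow neg_even neg_e3 P_def P'_def dilate_odd_compose_minus_X)
  have FP: "F * P = e 4 ^ 2 + fps_X * g ^ 2"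
    using theta_product_dissection unfolding theta_1_2 F_def P_def g_def e_def .
  \<comment> \<open>Conjugating the dissection restores \<open>theta 1 5\<close> and changes the
    sign of its odd part, giving the second relation for \<open>dissection_field\<close>.\<close>
  have "fps_compose F (- fps_X) = theta 1 5"
    by (simp add: F_def fps_eq_iff compose_minus_X_nth flip: power_mult_distrib mult.assoc)
  moreover have "fps_compose (fps_X * g ^ 2) (- fps_X) = - (fps_X * g ^ 2)"
    by (simp add: neg_mult neg_pow g_def dilate_even_compose_minus_X)
  ultimately have FP': "theta 1 5 * P' = e 4 ^ 2 - fps_X * g ^ 2"
    using arg_cong[OF FP, of "\<lambda>f. fps_compose f (- fps_X)"]
    by (simp add: neg_mult[of F] neg_pow neg_even fps_compose_add_distrib P_def P'_def
        dilate_odd_compose_minus_X)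
  define k where "k = (\<lambda>a b. (e 2 ^ 5 * e 4 ^ 5 * e 12 ^ 5 * inverse (e 6 ^ 15)) ^ 2 *
    inverse (a ^ 5 * e 2 ^ 5 * e 6 ^ 5 * inverse (b ^ 15)))"
  have gam: "gamma_fps = e 1 ^ 5 * e 2 ^ 5 * e 6 ^ 5 * inverse (e 3 ^ 15)"
    by (simp add: gamma_fps_def e_def)
  have dgam: "dilate 2 gamma_fps = e 2 ^ 5 * e 4 ^ 5 * e 12 ^ 5 * inverse (e 6 ^ 15)"
    unfolding gam by (simp add: dilate_mult dilate_power dilate_inverse dil e0 fps_power_zeroth)
  have kap: "kappa_fps = k (e 1) (e 3)"
    unfolding kappa_fps_def dgam k_def by (simp add: gam)
  have kap': "k' = k m (dilate 3 m)"
    unfolding k'_def kap k_def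
    by (simp add: neg_mult neg_pow fps_inverse_compose e0 fps_power_zeroth neg_even neg_e3)
       (simp add: m_def e1)
  have Lk: "L (k a b) = (L (e 2) ^ 5 * L (e 4) ^ 5 * L (e 12) ^ 5 / L (e 6) ^ 15) ^ 2 / 
      (L a ^ 5 * L (e 2) ^ 5 * L (e 6) ^ 5 / L b ^ 15)" if "a $ 0 = 1" "b $ 0 = 1" for a b
    unfolding k_def divide_inverse
    by (simp add: L_mult L_pow L_inv that e0 fps_power_zeroth)
  have "y = e 4 ^ 5 * e 12 * inverse (e 2 * e 6 ^ 5)"
    unfolding y_def xi_fps_def
    by (simp add: dilate_mult dilate_power dilate_inverse E_nth_0 fps_power_zeroth
        dilate_dilate flip: e_def) (simp add: e_def)
  hence Ly: "L y = L (e 4) ^ 5 * L (e 12) / (L (e 2) * L (e 6) ^ 5)"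
    unfolding divide_inverse by (simp add: L_mult L_pow L_inv e0 fps_power_zeroth)
  note H = m1 m3 F F' P P' FP FP'
  note LH = H[folded L_eq, unfolded L_mult L_pow L_add L_diff]
  have nz: "L (e k) \<noteq> 0" for k using e0 by (simp add: L_0)
  have S: "L (e 3) ^ 3 / L (e 1) + L (dilate 3 m) ^ 3 / L m = 
     2 * (L (e 4) ^ 3 * L (e 6) ^ 2 / (L (e 2) ^ 2 * L (e 12)))"
    by (rule dissection_field) (rule nz LH)+
  have dm0: "dilate 3 m $ 0 = 1" using m0 by (simp add: dilate_nth)
  note Q = quadratic_field[OF nz nz nz nz nz nz LH(1,2) S, folded Lk[OF e0(1) e0(1)] Lk[OF m0 dm0] Ly, folded kap kap']
  have num: "L (numeral n) = numeral n" for n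
    by (simp add: L_def)
  show "kappa_fps + k' = 2 * y ^ 3 * (16 * y ^ 2 - 20 * y + 5)"
    by (rule L_eq[THEN iffD1]) (simp only: L_mult L_pow L_add L_diff num Q)
  show "kappa_fps * k' = y ^ 5"
    by (rule L_eq[THEN iffD1]) (simp only: L_mult L_pow Q)
qed

section \<open>The polynomials in xi\<close>

text \<open>Exactly the expression inside the definite description of
  \<open>zeta_poly\<close>.\<close>

definition eval_int_poly :: "int poly \<Rightarrow> rat fps \<Rightarrow> rat fps" where
  "eval_int_poly p y = poly (map_poly (\<lambda>c. fps_const (of_int c)) p) y"

lemma eval_int_poly_0 [simp]: "eval_int_poly 0 y = 0"
  by (simp add: eval_int_poly_def)

lemma eval_int_poly_pCons [simp]:
  "eval_int_poly (pCons a p) y = fps_const (of_int a) + y * eval_int_poly p y"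
  by (simp add: eval_int_poly_def map_poly_pCons)

lemma eval_int_poly_1 [simp]: "eval_int_poly 1 y = 1"
  by (simp add: one_pCons)

lemma eval_int_poly_add: "eval_int_poly (p + q) y = eval_int_poly p y + eval_int_poly q y"
  by (induction p q rule: poly_induct2) (simp_all add: algebra_simps flip: fps_const_add)

lemma eval_int_poly_smult: "eval_int_poly (smult c p) y = fps_const (of_int c) * eval_int_poly p y"
  by (induction p) (simp_all add: algebra_simps flip: fps_const_mult)

lemma eval_int_poly_diff: "eval_int_poly (p - q) y = eval_int_poly p y - eval_int_poly q y"
  using eval_int_poly_add[of "p - q" q y] by simp

lemma eval_int_poly_mult: "eval_int_poly (p * q) y = eval_int_poly p y * eval_int_poly q y"
  by (induction p) (simp_all add: eval_int_poly_add eval_int_poly_smult algebra_simps)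

lemma eval_int_poly_pcompose: "eval_int_poly (pcompose p q) y = eval_int_poly p (eval_int_poly q y)"
  by (induction p) (simp_all add: pcompose_pCons eval_int_poly_add eval_int_poly_mult)

lemma dilate_eval_int_poly:
  "k > 0 \<Longrightarrow> dilate k (eval_int_poly p y) = eval_int_poly p (dilate k y)"
  by (induction p)
     (simp_all add: dilate_conv_compose fps_compose_add_distrib fps_compose_mult_distrib)

text \<open>The constant term of p(t) is that of p, so it vanishes; then t can be cancelled and the
  degree drops.\<close>

lemma eval_int_poly_eq_0:
  assumes "t $ 0 = 0" "t \<noteq> 0" "eval_int_poly p t = 0"
  shows "p = 0"
  using assms(3)
proof (induction p)
  case (pCons a p)
  have "a = 0"
    using arg_cong[OF pCons.prems, of "\<lambda>f. f $ 0"] assms(1) by simp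
  with pCons assms(2) show ?case by simp
qed simp

lemma xi_nth_0: "xi_fps $ 0 = 1"
  by (simp add: xi_fps_def fps_power_zeroth E_nth_0)

lemma xi_neq_1: "xi_fps \<noteq> 1"
proof
  assume "xi_fps = 1"
  let ?D = "E_fps * dilate 3 E_fps ^ 5"
  have "inverse ?D * ?D = 1"
    by (rule inverse_mult_eq_1) (simp add: E_nth_0 fps_power_zeroth)
  moreover have "dilate 2 E_fps ^ 5 * dilate 6 E_fps * inverse ?D * ?D = ?D"
    using \<open>xi_fps = 1\<close> by (simp add: xi_fps_def)
  ultimately have "dilate 2 (E_fps ^ 5) * dilate 6 E_fps = E_fps * dilate 3 (E_fps ^ 5)"
    by (simp add: mult.assoc dilate_power)
  \<comment> \<open>The coefficient of q is 0 on the left and -1 on the right.\<close>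
  hence "(dilate 2 (E_fps ^ 5) * dilate 6 E_fps) $ 1 = (E_fps * dilate 3 (E_fps ^ 5)) $ 1"
    by simp
  moreover have "E_fps $ 1 = -1"
    using E_nth[of 1 1] by (simp add: qfac_Suc)
  ultimately show False by (simp add: dilate_nth fps_power_zeroth E_nth_0)
qed

text \<open>xi has constant term 1, so the polynomials are first shifted to be evaluated at xi - 1.
  This is the uniqueness that makes \<open>zeta_poly\<close> well defined.\<close>

lemma eval_int_poly_xi_inject:
  assumes "eval_int_poly p xi_fps = eval_int_poly q xi_fps"
  shows "p = q"
proof -
  have "eval_int_poly (pcompose (p - q) [:1, 1:]) (xi_fps - 1) = 0"
    using assms by (simp add: eval_int_poly_pcompose eval_int_poly_diff)
  hence "pcompose (p - q) [:1, 1:] = 0"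
    by (rule eval_int_poly_eq_0[rotated 2]) (simp_all add: xi_nth_0 xi_neq_1)
  thus "p = q" by (simp add: pcompose_eq_0_iff)
qed

text \<open>With h = y^3 (16 y^2 - 20 y + 5), these are half the power sums of the roots of T^2 - 2
  h T + y^5. Halving keeps the coefficients integral, since the first two are 1 and h.\<close>

fun zeta_rec :: "nat \<Rightarrow> int poly" where
  "zeta_rec 0 = 1"
| "zeta_rec (Suc 0) = monom 1 3 * [:5, -20, 16:]"
| "zeta_rec (Suc (Suc i)) = smult 2 (monom 1 3 * [:5, -20, 16:]) * zeta_rec (Suc i) - monom 1 5 * zeta_rec i"

lemma eval_zeta_rec:
  fixes y :: "rat fps"
  assumes "a + b = 2 * y ^ 3 * (16 * y ^ 2 - 20 * y + 5)" "a * b = y ^ 5"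
  shows "2 * eval_int_poly (zeta_rec i) y = a ^ i + b ^ i"
proof -
  have X: "eval_int_poly (monom 1 k) y = y ^ k" for k
    by (induction k) (simp_all add: monom_Suc monom_0)
  have h: "eval_int_poly [:5, -20, 16:] y = 16 * y ^ 2 - 20 * y + 5"
    by (simp add: power2_eq_square algebra_simps flip: numeral_fps_const neg_numeral_fps_const)
  have s: "2 * (y ^ 3 * (16 * y ^ 2 - 20 * y + 5)) = a + b"
    using assms(1) by (simp only: mult.assoc)
  show ?thesis
  proof (induction i rule: zeta_rec.induct)
    case 2
    show ?case unfolding zeta_rec.simps eval_int_poly_mult X h s by simp
  next
    case (3 i)
    have "2 * eval_int_poly (zeta_rec (Suc (Suc i))) y
       = (2 * (y ^ 3 * (16 * y ^ 2 - 20 * y + 5))) * (2 * eval_int_poly (zeta_rec (Suc i)) y) 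
          - y ^ 5 * (2 * eval_int_poly (zeta_rec i) y)"
      unfolding zeta_rec.simps eval_int_poly_mult eval_int_poly_diff eval_int_poly_smult X h
      by (simp add: algebra_simps flip: numeral_fps_const)
    also have "\<dots> = a ^ Suc (Suc i) + b ^ Suc (Suc i)"
      unfolding 3 s assms(2) [symmetric] by (simp add: algebra_simps)
    finally show ?case .
  qed simp
qed

text \<open>Adding f(-q) cancels the odd coefficients and doubles the even ones.\<close>

lemma dilate_U_op: "2 * dilate 2 (U_op f) = f + fps_compose f (- fps_X)"
  unfolding mult_2
  by (rule fps_ext, unfold fps_add_nth) (auto simp: dilate_nth U_op_def compose_minus_X_nth)

text \<open>At q^2 both series, doubled, become kappa(q)^i + kappa(-q)^i. Injectivity of the
  dilation gives existence of the representation; injectivity of evaluation at xi gives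
  uniqueness.\<close>

lemma zeta_poly_0: "zeta_poly i 0 = zeta_rec i"
proof -
  let ?y = "dilate 2 xi_fps"
  have "2 * dilate 2 (eval_int_poly (zeta_rec i) xi_fps) = 2 * eval_int_poly (zeta_rec i) ?y"
    by (simp add: dilate_eval_int_poly)
  also have "\<dots> = kappa_fps ^ i + fps_compose kappa_fps (- fps_X) ^ i"
    by (intro eval_zeta_rec kappa_conjugate)
  also have "\<dots> = 2 * dilate 2 (U_op (kappa_fps ^ i))"
    by (simp add: dilate_U_op fps_compose_power)
  finally have "dilate 2 (U_op (kappa_fps ^ i)) = dilate 2 (eval_int_poly (zeta_rec i) xi_fps)"
    by simp
  hence U: "U_op (kappa_fps ^ i * xi_fps ^ 0) = eval_int_poly (zeta_rec i) xi_fps"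
    by (simp add: dilate_inject)
  show ?thesis
    unfolding zeta_poly_def U eval_int_poly_def [symmetric]
    by (rule the_equality) (auto dest: eval_int_poly_xi_inject)
qed

section \<open>2-adic valuations\<close>

text \<open>Substituting \<open>[:0, 4:]\<close> makes the \<open>M\<close>-th coefficient divisible by \<open>4^M\<close>.\<close>
lemma zeta_rec_structure:
  "\<exists>a b p r. zeta_rec (2 * n) = monom 1 (5 * n) * a \<and> zeta_rec (2 * n + 1) = monom 1 (5 * n + 3) * b
     \<and> smult 2 a = pcompose p [:0, 4:] \<and> b = pcompose r [:0, 4:]
     \<and> odd (coeff a 0) \<and> odd (coeff r 0) \<and> (odd (coeff p 1) \<longleftrightarrow> odd n)"
proof (induction n)
  case 0
  show ?case
    \<comment> \<open>In z = 4y one has 5 - 20y + 16y^2 = 5 - 5z + z^2, and the doubled constant 1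
      is 2.\<close>
    by (rule exI[of _ 1], rule exI[of _ "[:5, -20, 16:]"], rule exI[of _ "[:2:]"],
        rule exI[of _ "[:5, -5, 1:]"]) (simp add: pcompose_pCons)
next
  case (Suc n)
  then obtain a b p r where IH: "zeta_rec (2 * n) = monom 1 (5 * n) * a"
     "zeta_rec (2 * n + 1) = monom 1 (5 * n + 3) * b" "smult 2 a = pcompose p [:0, 4:]"
     "b = pcompose r [:0, 4:]" "odd (coeff a 0)" "odd (coeff r 0)" "odd (coeff p 1) \<longleftrightarrow> odd n"
    by blast
  define h hu where "h = [:5, -20, 16::int:]" and "hu = [:5, -5, 1::int:]"
  have h: "h = pcompose hu [:0, 4:]" by (simp add: h_def hu_def pcompose_pCons)
  \<comment> \<open>The recurrence divided by y^(5n+5), respectively y^(5n+8). The spare y in the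
    first case comes from 5n + 6 = (5n + 5) + 1.\<close>
  define a' where "a' = [:0, 2:] * h * b - a"
  define b' where "b' = smult 2 h * a' - b"
  \<comment> \<open>The same two recurrences in z = 4y: doubling a' turns the coefficient 2y into z,
    and the 2 in b' is absorbed by 2a'.\<close>
  define p' where "p' = [:0, 1:] * hu * r - p"
  define r' where "r' = hu * p' - r"
  have a': "smult 2 a' = pcompose p' [:0, 4:]"
    by (simp add: a'_def p'_def pcompose_diff pcompose_mult smult_diff_right h IH(3)
        flip: IH(4)) (simp add: pcompose_pCons pcompose_mult IH(4))
  have b': "b' = pcompose r' [:0, 4:]"
    by (simp add: b'_def r'_def pcompose_diff pcompose_mult h IH(4) flip: a')
  have step: "zeta_rec (Suc (Suc i)) = smult 2 (monom 1 3 * h) * zeta_rec (Suc i) - monom 1 5 * zeta_rec i" for i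
    by (simp add: h_def)
  have mm: "monom (1::int) (k + l) = monom 1 k * monom 1 l" for k l
    by (simp add: mult_monom)
  have x2: "[:0, 2:] = smult 2 (monom (1::int) 1)"
    by (simp add: monom_Suc monom_0)
  have za: "zeta_rec (2 * Suc n) = monom 1 (5 * Suc n) * a'"
  proof -
    have e: "5 * n + 3 + 3 = 5 + 5 * n + (1::nat)" by simp
    have "zeta_rec (2 * Suc n) = smult 2 (monom 1 (5 * n + 3 + 3) * (h * b)) - monom 1 (5 + 5 * n) * a"
      using step[of "2 * n"] IH(1,2) unfolding mm[of "5 * n + 3"] mm[of 5] by (simp add: mult_ac)
    also have "\<dots> = monom 1 (5 + 5 * n) * a'"
      unfolding e mm[of "5 + 5 * n" 1] a'_def x2 by (simp add: algebra_simps)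
    finally show ?thesis by simp
  qed
  have zb: "zeta_rec (2 * Suc n + 1) = monom 1 (5 * Suc n + 3) * b'"
  proof -
    have e: "5 * n + 3 + 5 = 5 * Suc n + 3" "3 + 5 * Suc n = 5 * Suc n + 3" by simp_all
    have "zeta_rec (2 * Suc n + 1) = smult 2 (monom 1 (3 + 5 * Suc n) * (h * a')) - monom 1 (5 * n + 3 + 5) * b"
      using step[of "2 * n + 1"] za IH(2) unfolding mm[of "5 * n + 3" 5] mm[of 3 "5 * Suc n"] by (simp add: mult_ac)
    also have "\<dots> = monom 1 (5 * Suc n + 3) * b'"
      unfolding e b'_def by (simp add: algebra_simps)
    finally show ?thesis .
  qed
  have "coeff a' 0 = - coeff a 0" by (simp add: a'_def mult.assoc)
  hence o1: "odd (coeff a' 0)" using IH(5) by simp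
  have "coeff p' 0 = 2 * coeff a' 0"
    using arg_cong[OF a', of "\<lambda>q. coeff q 0"] unfolding coeff_pcompose_linear by simp
  moreover have "coeff r' 0 = 5 * coeff p' 0 - coeff r 0" by (simp add: r'_def hu_def coeff_mult_0)
  ultimately have o2: "odd (coeff r' 0)" using IH(6) by simp
  \<comment> \<open>As r has odd constant term, each step flips the parity of the linear coefficient
    of p.\<close>
  have "coeff p' 1 = 5 * coeff r 0 - coeff p 1"
    by (simp add: p'_def hu_def mult.assoc coeff_mult_0)
  hence o3: "odd (coeff p' 1) \<longleftrightarrow> odd (Suc n)" using IH(6,7) by simp
  from za zb a' b' o1 o2 o3 show ?case by blast
qed

lemma nu2_ge: "2 ^ k dvd c \<Longrightarrow> nu2 c \<ge> enat k"
  by (auto simp: nu2_def intro!: multiplicity_geI)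

lemma nu2_odd: "odd c \<Longrightarrow> nu2 c = 0"
  by (auto simp: nu2_def not_dvd_imp_multiplicity_0 zero_enat_def)

lemma nu2_double_odd: "odd c \<Longrightarrow> nu2 (2 * c) = 1"
  by (auto simp: nu2_def multiplicity_times_same not_dvd_imp_multiplicity_0 one_enat_def)

theorem theorem4p2:
  fixes i :: nat
  shows "nu2 (Z i 0 (d_idx i 0)) = 0
    \<and> (i mod 4 = 2 \<longrightarrow> nu2 (Z i 0 (d_idx i 0 + 1)) = 1)
    \<and> (i mod 4 \<noteq> 2 \<longrightarrow> nu2 (Z i 0 (d_idx i 0 + 1)) \<ge> 2)
    \<and> (\<forall>M::nat. M \<ge> 2 \<longrightarrow> nu2 (Z i 0 (d_idx i 0 + M)) \<ge> enat (M + 1))"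
proof -
  define n where "n = i div 2"
  obtain a b p r where *: "zeta_rec (2 * n) = monom 1 (5 * n) * a"
     "zeta_rec (2 * n + 1) = monom 1 (5 * n + 3) * b" "smult 2 a = pcompose p [:0, 4:]"
     "b = pcompose r [:0, 4:]" "odd (coeff a 0)" "odd (coeff r 0)" "odd (coeff p 1) \<longleftrightarrow> odd n"
    using zeta_rec_structure[of n] by blast
  have four: "(4::int) ^ M = 2 ^ (2 * M)" for M by (simp add: power_mult)
  have two: "enat 2 = 2" by (simp add: numeral_eq_enat)
  show ?thesis
  proof (cases "even i")
    case True
    hence i: "i = 2 * n" by (simp add: n_def)
    have Z: "Z i 0 (d_idx i 0 + M) = coeff a M" for M
      by (simp add: Z_def zeta_poly_0 i d_idx_def *(1) coeff_monom_mult)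
    \<comment> \<open>So 2^(2M-1) divides a_M, which suffices for M >= 2. For M = 1 the coefficient
      is 2 p_1, decided by the parity of n.\<close>
    have pa: "2 * coeff a M = 4 ^ M * coeff p M" for M
      using arg_cong[OF *(3), of "\<lambda>q. coeff q M"] by (simp add: coeff_pcompose_linear)
    have a1: "coeff a 1 = 2 * coeff p 1" using pa[of 1] by simp
    have aM: "2 ^ (M + 1) dvd coeff a M" if "M \<ge> 2" for M
    proof -
      have "2 * M = Suc (M + 1 + (M - 2))" using that by simp
      hence "2 * coeff a M = 2 * (2 ^ (M + 1) * (2 ^ (M - 2) * coeff p M))"
        unfolding pa four by (simp only: power_Suc power_add mult.assoc)
      thus ?thesis by simp
    qed
    have "i mod 4 = 2 \<longleftrightarrow> odd n" unfolding i by presburger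
    moreover have "nu2 (coeff a 1) = 1" if "odd n"
      unfolding a1 using that *(7) by (intro nu2_double_odd) simp
    moreover have "nu2 (coeff a 1) \<ge> 2" if "even n"
      unfolding a1 two [symmetric] using that *(7) by (intro nu2_ge) (auto elim!: evenE)
    ultimately show ?thesis
      using nu2_odd[OF *(5)] nu2_ge[OF aM] Z[of 0] Z[of 1] by (simp add: Z)
  next
    case False
    hence i: "i = 2 * n + 1" by (simp add: n_def)
    \<comment> \<open>For odd i no halving is lost, and 2M >= M + 1 holds from M = 1 on.\<close>
    have Z: "Z i 0 (d_idx i 0 + M) = 4 ^ M * coeff r M" for M
      using *(2) by (simp add: Z_def zeta_poly_0 i d_idx_def coeff_monom_mult *(4) coeff_pcompose_linear)
    have "2 ^ (M + 1) dvd 4 ^ M * coeff r M" if "M \<ge> 1" for M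
      unfolding four using that by (intro dvd_mult2 le_imp_power_dvd) simp
    from this[THEN nu2_ge] have ge: "nu2 (4 ^ M * coeff r M) \<ge> enat (M + 1)" if "M \<ge> 1" for M
      using that by blast
    have "enat (1 + 1) \<le> nu2 (4 ^ 1 * coeff r 1)" by (rule ge) simp
    hence "2 \<le> nu2 (4 ^ 1 * coeff r 1)" by (simp only: one_add_one two)
    moreover have "i mod 4 \<noteq> 2" unfolding i by presburger
    ultimately show ?thesis
      using nu2_odd[OF *(6)] ge Z[of 0] Z[of 1] by (simp add: Z)
  qed
qed

end
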